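(* Let $F$ be a field, let $F(t)$ be the field of rational functions in one variable, and let $V=F(t)$, viewed as an $F(t)$-bimodule by multiplication. Fix an $F$-linear basis $\mathfrak{B}$ of $F(t)$ containing $1,t,t^2,\dots$, let $\ell:F(t)\to F$ be the $F$-linear functional defined on $\mathfrak{B}$ by $\ell(v)=1$ if $v=t^{2^k}$ for some integer $k\geq 1$, and $\ell(v)=0$ for every other $v\in\mathfrak{B}$, and let $\widetilde{B}(v,w)=\ell(vw)$ for $v,w\in V$. Let $S$ be the $F$-algebra $$S=\left(\begin{matrix} F & V & F\\ 0 & F(t) & V\\ 0 & 0 & F\end{matrix}\right)$$ with componentwise $F$-vector space structure and multiplication $$\left(\begin{matrix}\alpha_1 & v & \lambda\\ 0 & f & w\\ 0 & 0 & \alpha_2\end{matrix}\right)\left(\begin{matrix}\alpha_1' & v' & \lambda'\\ 0 & f' & w'\\ 0 & 0 & \alpha_2'\end{matrix}\right)=\left(\begin{matrix}\alpha_1\alpha_1' & \alpha_1v'+vf' & \alpha_1\lambda'+\alpha_2'\lambda+\widetilde{B}(v,w')\\ 0 & ff' & fw'+\alpha_2'w\\ 0 & 0 & \alpha_2\alpha_2'\end{matrix}\right).$$ Then $S$ is a semiprimary PI-algebra whose nilradical $N$ satisfies $N^3=0$, and $S$ is not weakly representable.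
   Context: Algebras are associative with unit. A PI-algebra is an algebra satisfying a nontrivial polynomial identity. A ring $S$ with nilradical $\operatorname{Nil}(S)$ is semiprimary if $\operatorname{Nil}(S)$ is nilpotent and $S/\operatorname{Nil}(S)$ is semisimple Artinian. An algebra is weakly representable if it embeds (as a ring) into a matrix ring $M_n(C)$ for some $n\geq 1$ and some commutative ring $C$. *)

theory Defs
  imports
    "HOL-Library.Poly_Mapping"
    "HOL-Computational_Algebra.Polynomial"
    "HOL-Computational_Algebra.Fraction_Field"
    "HOL-Algebra.Module"
    "HOL-Algebra.QuotRing"
    "HOL-Algebra.Ideal_Product"
    "Jordan_Normal_Form.Matrix"
begin

text \<open>
  The ground field is a type of class \<^class>\<open>field\<close>; algebras over it are
  \<^typ>\<open>('k, 'a) module\<close> records, which carry both a ring and a scalar multiplication.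
  The library locale \<^locale>\<open>algebra\<close> forces the multiplication to be commutative and
  is therefore not usable here.
\<close>

definition field_ring :: "'k::field ring" where
  "field_ring = \<lparr>carrier = UNIV, mult = (*), one = 1, zero = 0, add = (+)\<rparr>"

definition unital_algebra :: "('k::field, 'a) module \<Rightarrow> bool" where
  "unital_algebra A \<longleftrightarrow> ring A \<and> Module.module (field_ring :: 'k ring) A \<and>
     (\<forall>c. \<forall>x\<in>carrier A. \<forall>y\<in>carrier A.
        (c \<odot>\<^bsub>A\<^esub> x) \<otimes>\<^bsub>A\<^esub> y = c \<odot>\<^bsub>A\<^esub> (x \<otimes>\<^bsub>A\<^esub> y) \<and>
        x \<otimes>\<^bsub>A\<^esub> (c \<odot>\<^bsub>A\<^esub> y) = c \<odot>\<^bsub>A\<^esub> (x \<otimes>\<^bsub>A\<^esub> y))"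


subsection \<open>Polynomial identities\<close>

text \<open>
  An element of the free associative algebra on countably many letters is a finitely supported
  function from words (lists of letter indices) to coefficients.
\<close>

type_synonym 'k nc_poly = "nat list \<Rightarrow>\<^sub>0 'k"

definition eval_word :: "('a, 'b) ring_scheme \<Rightarrow> (nat \<Rightarrow> 'a) \<Rightarrow> nat list \<Rightarrow> 'a" where
  "eval_word A x u = foldr (\<otimes>\<^bsub>A\<^esub>) (map x u) \<one>\<^bsub>A\<^esub>"

definition eval_nc :: "('k::field, 'a) module \<Rightarrow> (nat \<Rightarrow> 'a) \<Rightarrow> 'k nc_poly \<Rightarrow> 'a" where
  "eval_nc A x p =
     (\<Oplus>\<^bsub>A\<^esub>u\<in>Poly_Mapping.keys p. Poly_Mapping.lookup p u \<odot>\<^bsub>A\<^esub> eval_word A x u)"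

definition PI_algebra :: "('k::field, 'a) module \<Rightarrow> bool" where
  "PI_algebra A \<longleftrightarrow> unital_algebra A \<and>
     (\<exists>p. p \<noteq> 0 \<and> (\<forall>x. range x \<subseteq> carrier A \<longrightarrow> eval_nc A x p = \<zero>\<^bsub>A\<^esub>))"


subsection \<open>Semiprimary rings\<close>

definition nil_ideal :: "'a set \<Rightarrow> ('a, 'b) ring_scheme \<Rightarrow> bool" where
  "nil_ideal I R \<longleftrightarrow> ideal I R \<and> (\<forall>x\<in>I. \<exists>n::nat. x [^]\<^bsub>R\<^esub> n = \<zero>\<^bsub>R\<^esub>)"

text \<open>The (upper) nilradical: the sum of all two-sided nil ideals.\<close>

definition nilradical :: "('a, 'b) ring_scheme \<Rightarrow> 'a set" where
  "nilradical R = Idl\<^bsub>R\<^esub> (\<Union>{I. nil_ideal I R})"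

primrec ideal_pow :: "('a, 'b) ring_scheme \<Rightarrow> 'a set \<Rightarrow> nat \<Rightarrow> 'a set" where
  "ideal_pow R I 0 = carrier R"
| "ideal_pow R I (Suc n) = ideal_pow R I n \<cdot>\<^bsub>R\<^esub> I"

definition nilpotent_ideal :: "'a set \<Rightarrow> ('a, 'b) ring_scheme \<Rightarrow> bool" where
  "nilpotent_ideal I R \<longleftrightarrow> ideal I R \<and> (\<exists>n. ideal_pow R I n = {\<zero>\<^bsub>R\<^esub>})"

definition left_ideal :: "'a set \<Rightarrow> ('a, 'b) ring_scheme \<Rightarrow> bool" where
  "left_ideal I R \<longleftrightarrow> additive_subgroup I R \<and> (\<forall>a\<in>I. \<forall>x\<in>carrier R. x \<otimes>\<^bsub>R\<^esub> a \<in> I)"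

definition left_artinian :: "('a, 'b) ring_scheme \<Rightarrow> bool" where
  "left_artinian R \<longleftrightarrow> ring R \<and>
     (\<forall>I :: nat \<Rightarrow> 'a set. (\<forall>n. left_ideal (I n) R) \<and> (\<forall>n. I (Suc n) \<subseteq> I n)
        \<longrightarrow> (\<exists>m. \<forall>n\<ge>m. I n = I m))"

definition minimal_left_ideal :: "'a set \<Rightarrow> ('a, 'b) ring_scheme \<Rightarrow> bool" where
  "minimal_left_ideal I R \<longleftrightarrow> left_ideal I R \<and> I \<noteq> {\<zero>\<^bsub>R\<^esub>} \<and>
     (\<forall>J. left_ideal J R \<and> J \<subseteq> I \<longrightarrow> J = {\<zero>\<^bsub>R\<^esub>} \<or> J = I)"

text \<open>
  A ring is semisimple if, as a left module over itself, it is the sum of its simple submodules.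
  The sum of a family of left ideals is the least left ideal containing all of them.
\<close>

definition semisimple_ring :: "('a, 'b) ring_scheme \<Rightarrow> bool" where
  "semisimple_ring R \<longleftrightarrow> ring R \<and>
     carrier R = \<Inter>{J. left_ideal J R \<and> \<Union>{I. minimal_left_ideal I R} \<subseteq> J}"

definition semiprimary :: "('a, 'b) ring_scheme \<Rightarrow> bool" where
  "semiprimary R \<longleftrightarrow> ring R \<and> nilpotent_ideal (nilradical R) R \<and>
     semisimple_ring (R Quot nilradical R) \<and> left_artinian (R Quot nilradical R)"


subsection \<open>Weak representability\<close>

text \<open>
  HOL cannot quantify over types inside a formula, so the commutative coefficient ring is a type
  argument. That a ring is not weakly representable is stated by negating this predicate for
  an arbitrary type of class \<^class>\<open>comm_ring_1\<close>, which ranges over all nonzero commutative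
  rings. The zero ring is irrelevant, as its matrix rings are zero.
\<close>

definition weakly_representable :: "'c::comm_ring_1 itself \<Rightarrow> ('a, 'b) ring_scheme \<Rightarrow> bool" where
  "weakly_representable C R \<longleftrightarrow>
     (\<exists>n\<ge>1. \<exists>\<phi>. \<phi> \<in> Ring.ring_hom R (ring_mat C n ()) \<and> inj_on \<phi> (carrier R))"


subsection \<open>The field of rational functions as a vector space\<close>

type_synonym 'k ratfun = "'k poly fract"

definition ratfun_scale :: "'k::field \<Rightarrow> 'k ratfun \<Rightarrow> 'k ratfun" where
  "ratfun_scale c f = Fract [:c:] 1 * f"

definition ratfun_t :: "'k::field ratfun" where
  "ratfun_t = Fract [:0, 1:] 1"

global_interpretation ratfun: vector_space "ratfun_scale :: 'k::field \<Rightarrow> _"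
proof
  fix a b :: 'k and x y :: "'k ratfun"
  show "ratfun_scale a (x + y) = ratfun_scale a x + ratfun_scale a y"
    by (simp add: ratfun_scale_def algebra_simps)
  have "Fract [:a + b:] 1 = Fract [:a:] 1 + (Fract [:b:] 1 :: 'k ratfun)"
    by simp
  then show "ratfun_scale (a + b) x = ratfun_scale a x + ratfun_scale b x"
    by (simp only: ratfun_scale_def distrib_right)
  have "Fract [:a * b:] 1 = Fract [:a:] 1 * (Fract [:b:] 1 :: 'k ratfun)"
    by (simp add: mult.commute)
  then show "ratfun_scale a (ratfun_scale b x) = ratfun_scale (a * b) x"
    by (simp add: ratfun_scale_def mult.assoc)
  show "ratfun_scale 1 x = x"
    by (simp add: ratfun_scale_def One_fract_def [symmetric] one_pCons [symmetric])
qed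


subsection \<open>The triangular algebra\<close>

text \<open>\<open>Tri \<alpha>\<^sub>1 v \<lambda> f w \<alpha>\<^sub>2\<close> lists the upper triangular entries row by row.\<close>

datatype ('k, 'v) upper_tri = Tri 'k 'v 'k 'v 'v 'k

type_synonym 'k tri = "('k, 'k ratfun) upper_tri"

definition bil :: "('k::field ratfun \<Rightarrow> 'k) \<Rightarrow> 'k ratfun \<Rightarrow> 'k ratfun \<Rightarrow> 'k" where
  "bil ell v w = ell (v * w)"

fun tri_mult :: "('k::field ratfun \<Rightarrow> 'k) \<Rightarrow> 'k tri \<Rightarrow> 'k tri \<Rightarrow> 'k tri" where
  "tri_mult ell (Tri a1 v l f w a2) (Tri a1' v' l' f' w' a2') =
     Tri (a1 * a1') (ratfun_scale a1 v' + v * f') (a1 * l' + a2' * l + bil ell v w')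
         (f * f') (f * w' + ratfun_scale a2' w)
         (a2 * a2')"

fun tri_add :: "'k::field tri \<Rightarrow> 'k tri \<Rightarrow> 'k tri" where
  "tri_add (Tri a1 v l f w a2) (Tri a1' v' l' f' w' a2') =
     Tri (a1 + a1') (v + v') (l + l') (f + f') (w + w') (a2 + a2')"

fun tri_smult :: "'k::field \<Rightarrow> 'k tri \<Rightarrow> 'k tri" where
  "tri_smult c (Tri a1 v l f w a2) =
     Tri (c * a1) (ratfun_scale c v) (c * l) (ratfun_scale c f) (ratfun_scale c w) (c * a2)"

definition tri_algebra :: "('k::field ratfun \<Rightarrow> 'k) \<Rightarrow> ('k, 'k tri) module" where
  "tri_algebra ell =
     \<lparr>carrier = UNIV, mult = tri_mult ell, one = Tri 1 0 0 1 0 1,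
      zero = Tri 0 0 0 0 0 0, add = tri_add, smult = tri_smult\<rparr>"

end

theory Submission
  imports Defs "Jordan_Normal_Form.Char_Poly"
begin

text \<open>
  Modulo the strictly triangular matrices \<open>N\<close> the algebra is the product of fields
  \<open>F \<times> F(t) \<times> F\<close>, and \<open>N\<^sup>3 = 0\<close>; hence \<open>S\<close> is semiprimary, and any product of three commutators
  vanishes.

  Under an embedding \<open>\<phi>\<close> of \<open>S\<close> into \<open>n \<times> n\<close> matrices over a commutative ring \<open>C\<close>, the
  Cayley-Hamilton theorem for \<open>\<phi>(t e\<^sub>2\<^sub>2)\<close>, multiplied by \<open>\<phi>(t\<^sup>m e\<^sub>1\<^sub>2)\<close> on the left and by
  \<open>\<phi>(e\<^sub>2\<^sub>3)\<close> on the right, is a monic linear recurrence of order \<open>n\<close> over \<open>C\<close> for the sequence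
  \<open>\<phi>(\<ell>(t\<^sup>j) e\<^sub>1\<^sub>3)\<close>. The exponents \<open>j = 2\<^sup>k\<close> with \<open>\<ell>(t\<^sup>j) = 1\<close> have gaps longer than \<open>n\<close>, so
  the recurrence forces \<open>\<phi>(e\<^sub>1\<^sub>3) = 0\<close>.
\<close>

section \<open>Cayley-Hamilton over a commutative ring\<close>

text \<open>The adjugate of \<open>x I - A\<close> is a polynomial in \<open>x\<close> with matrix
  coefficients \<open>B k\<close>. Comparing coefficients in
  \<open>(x I - A) adj(x I - A) = char_poly A I\<close> expresses each coefficient of
  \<open>char_poly A\<close> through \<open>B (k - 1)\<close> and \<open>A B k\<close>;
  multiplication by \<open>A ^ k\<close> from the left makes the sum telescope.\<close>

lemma cayley_hamilton_entries:
  fixes A :: "'c::comm_ring_1 mat"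
  assumes A: "A \<in> carrier_mat n n" and ij: "i < n" "j < n"
  shows "(\<Sum>k\<le>n. coeff (char_poly A) k * (A ^\<^sub>m k) $$ (i, j)) = 0"
proof -
  define X where "X = adj_mat (char_poly_matrix A)"
  have XC: "X \<in> carrier_mat n n"
    unfolding X_def by (rule adj_mat(1)) (use A in simp)
  have eq: "char_poly_matrix A * X = char_poly A \<cdot>\<^sub>m 1\<^sub>m n"
    unfolding X_def char_poly_def by (rule adj_mat(2)) (use A in simp)
  define B where "B k = mat n n (\<lambda>(i, j). coeff (X $$ (i, j)) k)" for k
  have BC: "B k \<in> carrier_mat n n" for k by (simp add: B_def)
  \<comment> \<open>\<open>B'\<close> holds the coefficients of \<open>x\<close> times the adjugate:
    \<open>B\<close> shifted by one place, with zero at 0.\<close>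
  define B' where "B' k = (case k of 0 \<Rightarrow> 0\<^sub>m n n | Suc m \<Rightarrow> B m)" for k
  have B'C: "B' k \<in> carrier_mat n n" for k by (simp add: B'_def BC split: nat.split)
  have coeffs: "coeff (char_poly A) k \<cdot>\<^sub>m 1\<^sub>m n = B' k - A * B k" for k
  proof (rule eq_matI)
    fix a b assume ab: "a < dim_row (B' k - A * B k)" "b < dim_col (B' k - A * B k)"
    then have ab: "a < n" "b < n" using BC[of k] A by auto
    have "(char_poly A \<cdot>\<^sub>m 1\<^sub>m n) $$ (a, b) =
        (\<Sum>l<n. char_poly_matrix A $$ (a, l) * X $$ (l, b))"
      unfolding eq[symmetric] using A XC ab
      by (auto simp: scalar_prod_def atLeast0LessThan char_poly_matrix_def intro!: sum.cong)
    \<comment> \<open>An entry of \<open>x I - A\<close> is split into its part \<open>x\<close> on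
      the diagonal and the constant \<open>- A $$ (a, l)\<close>.\<close>
    also have "\<dots> = (\<Sum>l<n. (if a = l then [:0, 1:] * X $$ (l, b) else 0)
                          + [: - A $$ (a, l) :] * X $$ (l, b))"
      by (rule sum.cong) (use A ab in \<open>auto simp: char_poly_matrix_def algebra_simps\<close>)
    also have "\<dots> = [:0, 1:] * X $$ (a, b) - (\<Sum>l<n. Polynomial.smult (A $$ (a, l)) (X $$ (l, b)))"
      unfolding sum.distrib sum.delta'[OF finite_lessThan] using ab by (simp add: sum_negf)
    finally have "coeff ((char_poly A \<cdot>\<^sub>m 1\<^sub>m n) $$ (a, b)) k =
        coeff ([:0, 1:] * X $$ (a, b)) k - (\<Sum>l<n. A $$ (a, l) * coeff (X $$ (l, b)) k)"
      by (simp add: coeff_sum)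
    moreover have "coeff ((char_poly A \<cdot>\<^sub>m 1\<^sub>m n) $$ (a, b)) k = (coeff (char_poly A) k \<cdot>\<^sub>m 1\<^sub>m n) $$ (a, b)"
      using ab by simp
    moreover have "coeff ([:0, 1:] * X $$ (a, b)) k = B' k $$ (a, b)"
      using ab by (cases k) (auto simp: B'_def B_def)
    moreover have "(A * B k) $$ (a, b) = (\<Sum>l<n. A $$ (a, l) * coeff (X $$ (l, b)) k)"
      using ab A BC[of k] by (simp add: scalar_prod_def atLeast0LessThan B_def)
    ultimately show "(coeff (char_poly A) k \<cdot>\<^sub>m 1\<^sub>m n) $$ (a, b) = (B' k - A * B k) $$ (a, b)"
      using ab A BC[of k] B'C[of k] by simp
  qed (use A BC[of k] in auto)
  define G where "G k = (A ^\<^sub>m k * B' k) $$ (i, j)" for k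
  have PC: "A ^\<^sub>m k \<in> carrier_mat n n" for k using A by simp
  have step: "coeff (char_poly A) k * (A ^\<^sub>m k) $$ (i, j) = G k - G (Suc k)" for k
  proof -
    have "coeff (char_poly A) k \<cdot>\<^sub>m A ^\<^sub>m k = A ^\<^sub>m k * (coeff (char_poly A) k \<cdot>\<^sub>m 1\<^sub>m n)"
      using mult_smult_distrib[OF PC[of k] one_carrier_mat, of "coeff (char_poly A) k"]
        right_mult_one_mat[OF PC[of k]] by simp
    also have "\<dots> = A ^\<^sub>m k * B' k - A ^\<^sub>m k * (A * B k)"
      unfolding coeffs by (rule mult_minus_distrib_mat[OF PC B'C]) (use A BC[of k] in simp)
    also have "A ^\<^sub>m k * (A * B k) = A ^\<^sub>m Suc k * B' (Suc k)"
      using assoc_mult_mat[OF PC[of k] A BC[of k]] by (simp add: B'_def)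
    finally have "(coeff (char_poly A) k \<cdot>\<^sub>m A ^\<^sub>m k) $$ (i, j) =
        (A ^\<^sub>m k * B' k - A ^\<^sub>m Suc k * B' (Suc k)) $$ (i, j)" by simp
    then show ?thesis
      unfolding G_def using ij PC[of k] PC[of "Suc k"] B'C[of "Suc k"] A
      by (simp del: pow_mat.simps index_mult_mat(1))
  qed
  \<comment> \<open>\<open>K\<close> exceeds \<open>n\<close>, so the sum up to \<open>K\<close>
    covers all of \<open>char_poly A\<close>. It also makes \<open>B (K - 1)\<close> vanish: an
    entry exists only if \<open>n > 0\<close>, so \<open>K - 1\<close> is strictly above every
    degree.\<close>
  define K where "K = Suc (n + (\<Sum>a<n. \<Sum>b<n. degree (X $$ (a, b))))"
  have "B (K - 1) = 0\<^sub>m n n"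
  proof (rule eq_matI)
    fix a b assume "a < dim_row (0\<^sub>m n n :: 'c mat)" "b < dim_col (0\<^sub>m n n :: 'c mat)"
    then have ab: "a < n" "b < n" by auto
    have "degree (X $$ (a, b)) \<le> (\<Sum>b<n. degree (X $$ (a, b)))"
      by (rule member_le_sum) (use ab in auto)
    also have "\<dots> \<le> (\<Sum>a<n. \<Sum>b<n. degree (X $$ (a, b)))"
      by (rule member_le_sum[where f = "\<lambda>a. \<Sum>b<n. degree (X $$ (a, b))"]) (use ab in auto)
    finally have "degree (X $$ (a, b)) < K - 1" using ab by (simp add: K_def)
    then show "B (K - 1) $$ (a, b) = 0\<^sub>m n n $$ (a, b)"
      using ab by (simp add: B_def coeff_eq_0)
  qed (auto simp: B_def)
  then have GK: "G K = 0"
    using right_mult_zero_mat[OF PC[of K], of n] ij by (simp add: G_def B'_def K_def)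
  have G0: "G 0 = 0"
    using right_mult_zero_mat[OF PC[of 0], of n] ij by (simp add: G_def B'_def)
  have "(\<Sum>k\<le>n. coeff (char_poly A) k * (A ^\<^sub>m k) $$ (i, j)) =
        (\<Sum>k<K. coeff (char_poly A) k * (A ^\<^sub>m k) $$ (i, j))"
    by (rule sum.mono_neutral_left)
      (use degree_monic_char_poly[OF A] in \<open>auto simp: K_def coeff_eq_0\<close>)
  also have "\<dots> = (\<Sum>k<K. G k - G (Suc k))" by (simp add: step)
  also have "\<dots> = G 0 - G K" by (rule sum_lessThan_telescope')
  finally show ?thesis by (simp add: G0 GK)
qed

text \<open>For fixed \<open>L\<close> and \<open>R\<close>, an entry of \<open>L P R\<close> is a
  linear combination of the entries of \<open>P\<close>, so the entrywise identity for the powers of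
  \<open>A\<close> carries over. With suitable \<open>L\<close> and \<open>R\<close> this becomes a
  scalar recurrence.\<close>

lemma char_poly_between_mats:
  fixes A :: "'c::comm_ring_1 mat"
  assumes A: "A \<in> carrier_mat n n" and L: "L \<in> carrier_mat n n" and R: "R \<in> carrier_mat n n"
    and ij: "i < n" "j < n"
  shows "(\<Sum>k\<le>n. coeff (char_poly A) k * (L * A ^\<^sub>m k * R) $$ (i, j)) = 0"
proof -
  let ?c = "coeff (char_poly A)"
  have PC: "A ^\<^sub>m k \<in> carrier_mat n n" for k using A by simp
  have entry: "(L * P * R) $$ (i, j) =
      (\<Sum>b<n. \<Sum>a<n. L $$ (i, a) * R $$ (b, j) * P $$ (a, b))"
    if "P \<in> carrier_mat n n" for P
    using ij L R that
    by (subst sum.swap)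
      (simp add: scalar_prod_def atLeast0LessThan sum_distrib_left sum_distrib_right mult_ac)
  have "(\<Sum>k\<le>n. ?c k * (L * A ^\<^sub>m k * R) $$ (i, j)) =
      (\<Sum>k\<le>n. \<Sum>b<n. \<Sum>a<n. L $$ (i, a) * R $$ (b, j) * (?c k * (A ^\<^sub>m k) $$ (a, b)))"
    by (simp add: entry[OF PC] sum_distrib_left mult_ac)
  also have "\<dots> = (\<Sum>b<n. \<Sum>k\<le>n. \<Sum>a<n. L $$ (i, a) * R $$ (b, j) * (?c k * (A ^\<^sub>m k) $$ (a, b)))"
    by (rule sum.swap)
  also have "\<dots> = (\<Sum>b<n. \<Sum>a<n. \<Sum>k\<le>n. L $$ (i, a) * R $$ (b, j) * (?c k * (A ^\<^sub>m k) $$ (a, b)))"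
    by (rule sum.cong[OF refl sum.swap])
  also have "\<dots> = (\<Sum>b<n. \<Sum>a<n. L $$ (i, a) * R $$ (b, j) * (\<Sum>k\<le>n. ?c k * (A ^\<^sub>m k) $$ (a, b)))"
    by (simp only: sum_distrib_left)
  also have "\<dots> = 0"
    by (simp add: cayley_hamilton_entries[OF A])
  finally show ?thesis .
qed

section \<open>Semisimple Artinian rings from a central decomposition of the identity\<close>

text \<open>From an index of least cardinality on, no set can shrink further. Applied below to the
  traces of a chain of left ideals on a finite set.\<close>

lemma decreasing_finite_stabilises:
  fixes E :: "nat \<Rightarrow> 'a set"
  assumes "finite (E 0)" and dec: "\<And>n. E (Suc n) \<subseteq> E n"
  shows "\<exists>m. \<forall>n\<ge>m. E n = E m"
proof -
  have anti: "E n \<subseteq> E m" if "m \<le> n" for m n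
    using lift_Suc_antimono_le[of E] dec that by blast
  have fin: "finite (E n)" for n
    using assms(1) anti[of 0 n] finite_subset by blast
  obtain m where m: "\<And>n. card (E m) \<le> card (E n)"
    using ex_has_least_nat[of "\<lambda>_. True" 0 "\<lambda>n. card (E n)"] by auto
  have "E n = E m" if "n \<ge> m" for n
    using card_seteq[OF fin anti[OF that] m] .
  then show ?thesis by blast
qed

lemma (in ring) left_ideal_finsum:
  assumes J: "left_ideal J R" and "finite E" and "\<And>e. e \<in> E \<Longrightarrow> f e \<in> J"
  shows "finsum R f E \<in> J"
proof -
  interpret J: additive_subgroup J R using J by (simp add: left_ideal_def)
  show ?thesis using assms(2,3)
  proof (induction E rule: finite_induct)
    case empty
    then show ?case by simp
  next
    case (insert e E)
    have "finsum R f (insert e E) = f e \<oplus> finsum R f E"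
      using insert by (intro finsum_insert) (auto simp: J.a_Hcarr)
    then show ?case using insert by simp
  qed
qed

text \<open>The last hypothesis says that each left ideal \<open>R e\<close> is zero or simple.\<close>

lemma (in ring) semisimple_artinian_of_central_decomposition:
  assumes fin: "finite E" and E: "E \<subseteq> carrier R" and one: "(\<Oplus>e\<in>E. e) = \<one>"
    and central: "\<And>x e. x \<in> carrier R \<Longrightarrow> e \<in> E \<Longrightarrow> x \<otimes> e = e \<otimes> x"
    and simple: "\<And>x e. x \<in> carrier R \<Longrightarrow> e \<in> E \<Longrightarrow>
      x \<otimes> e = \<zero> \<or> (\<exists>y\<in>carrier R. y \<otimes> (x \<otimes> e) = e)"
  shows "semisimple_ring R" and "left_artinian R"
proof -
  have decomp: "x = (\<Oplus>e\<in>E. x \<otimes> e)" if "x \<in> carrier R" for x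
  proof -
    have "x = x \<otimes> (\<Oplus>e\<in>E. e)" using that by (simp add: one)
    also have "\<dots> = (\<Oplus>e\<in>E. x \<otimes> e)" using that E fin by (intro finsum_rdistr) auto
    finally show ?thesis .
  qed
  \<comment> \<open>By \<open>simple\<close>, some left multiple of the nonzero element
    \<open>x \<otimes> e\<close> is \<open>e\<close> itself.\<close>
  have mem: "e \<in> J" if J: "left_ideal J R" and "x \<in> carrier R" "e \<in> E" "x \<otimes> e \<in> J" "x \<otimes> e \<noteq> \<zero>"
    for J x e
    using simple[OF that(2,3)] that unfolding left_ideal_def by metis
  \<comment> \<open>A left ideal is determined by the members of \<open>E\<close> that it contains.
    Centrality puts the components \<open>x \<otimes> e\<close> of its elements into
    \<open>J\<close>, and a nonzero component puts \<open>e\<close> there; conversely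
    \<open>x\<close> is the sum of its components.\<close>
  have shape: "J = {x \<in> carrier R. \<forall>e\<in>E. x \<otimes> e = \<zero> \<or> e \<in> J}" if J: "left_ideal J R" for J
  proof -
    interpret J: additive_subgroup J R using J by (simp add: left_ideal_def)
    show ?thesis
    proof (intro Set.set_eqI iffI)
      fix x assume x: "x \<in> J"
      then have xc: "x \<in> carrier R" by (rule J.a_Hcarr)
      have "x \<otimes> e \<in> J" if "e \<in> E" for e
        using central[OF xc that] x that J E by (auto simp: left_ideal_def)
      then have "x \<otimes> e = \<zero> \<or> e \<in> J" if "e \<in> E" for e
        using mem[OF J xc that] that by metis
      then show "x \<in> {x \<in> carrier R. \<forall>e\<in>E. x \<otimes> e = \<zero> \<or> e \<in> J}"
        using xc by simp
    next
      fix x assume x: "x \<in> {x \<in> carrier R. \<forall>e\<in>E. x \<otimes> e = \<zero> \<or> e \<in> J}"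
      have "x \<otimes> e \<in> J" if e: "e \<in> E" for e
        using x J e J.zero_closed by (auto simp: left_ideal_def)
      then have "(\<Oplus>e\<in>E. x \<otimes> e) \<in> J" by (intro left_ideal_finsum[OF J fin]) auto
      then show "x \<in> J" using decomp[of x] x by simp
    qed
  qed
  show "left_artinian R"
    unfolding left_artinian_def
  proof (intro conjI allI impI)
    show "ring R" by (rule ring_axioms)
    fix I :: "nat \<Rightarrow> 'a set"
    assume I: "(\<forall>n. left_ideal (I n) R) \<and> (\<forall>n. I (Suc n) \<subseteq> I n)"
    then obtain m where m: "\<And>n. n \<ge> m \<Longrightarrow> I n \<inter> E = I m \<inter> E"
      using decreasing_finite_stabilises[of "\<lambda>n. I n \<inter> E"] fin by blast
    have "I n = I m" if "n \<ge> m" for n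
    proof -
      have iff: "e \<in> I n \<longleftrightarrow> e \<in> I m" if "e \<in> E" for e using m[OF \<open>n \<ge> m\<close>] that by blast
      have left: "left_ideal (I k) R" for k using I by blast
      have "I n = {x \<in> carrier R. \<forall>e\<in>E. x \<otimes> e = \<zero> \<or> e \<in> I n}" by (rule shape[OF left])
      also have "\<dots> = {x \<in> carrier R. \<forall>e\<in>E. x \<otimes> e = \<zero> \<or> e \<in> I m}"
        by (simp add: iff)
      also have "\<dots> = I m" by (rule shape[OF left, symmetric])
      finally show ?thesis .
    qed
    then show "\<exists>m. \<forall>n\<ge>m. I n = I m" by blast
  qed
  \<comment> \<open>The left ideal \<open>R e\<close> is minimal: a left ideal inside it either
    contains \<open>e\<close>, and then all of \<open>R e\<close>, or is zero by
    \<open>mem\<close>.\<close>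
  have minimal: "\<exists>I. minimal_left_ideal I R \<and> e \<in> I" if e: "e \<in> E" "e \<noteq> \<zero>" for e
  proof -
    have ec: "e \<in> carrier R" using e E by blast
    define I where "I = (\<lambda>x. x \<otimes> e) ` carrier R"
    have eI: "e \<in> I" unfolding I_def by (rule image_eqI[of _ _ \<one>]) (use ec in auto)
    have "left_ideal I R"
      unfolding left_ideal_def
    proof (intro conjI ballI)
      show "additive_subgroup I R"
      proof (rule additive_subgroupI, unfold I_def, rule add.subgroupI)
        show "(\<lambda>x. x \<otimes> e) ` carrier R \<noteq> {}" by auto
        show "\<ominus> a \<in> (\<lambda>x. x \<otimes> e) ` carrier R" if "a \<in> (\<lambda>x. x \<otimes> e) ` carrier R" for a
          using that ec l_minus[symmetric] by auto
        show "a \<oplus> b \<in> (\<lambda>x. x \<otimes> e) ` carrier R"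
          if "a \<in> (\<lambda>x. x \<otimes> e) ` carrier R" "b \<in> (\<lambda>x. x \<otimes> e) ` carrier R" for a b
          using that ec l_distr[symmetric] by auto
      qed (use ec in auto)
      show "x \<otimes> a \<in> I" if "a \<in> I" "x \<in> carrier R" for a x
        using that ec m_assoc[symmetric] by (auto simp: I_def)
    qed
    moreover have "J = {\<zero>} \<or> J = I" if J: "left_ideal J R" "J \<subseteq> I" for J
    proof (cases "e \<in> J")
      case True
      then have "I \<subseteq> J" using J by (auto simp: I_def left_ideal_def)
      then show ?thesis using J by blast
    next
      case False
      have "x = \<zero>" if "x \<in> J" for x
        using that J mem[OF J(1) _ e(1)] False by (auto simp: I_def)
      moreover have "\<zero> \<in> J" using J by (auto simp: left_ideal_def additive_subgroup.zero_closed)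
      ultimately show ?thesis by blast
    qed
    ultimately show ?thesis using e eI unfolding minimal_left_ideal_def by blast
  qed
  have "x \<in> J" if x: "x \<in> carrier R" and J: "left_ideal J R" "\<Union>{I. minimal_left_ideal I R} \<subseteq> J" for x J
  proof -
    have "e \<in> J" if "e \<in> E" for e
      using minimal[OF that] J
      by (cases "e = \<zero>") (auto simp: left_ideal_def additive_subgroup.zero_closed)
    then show ?thesis using shape[OF J(1)] x by blast
  qed
  moreover have "left_ideal (carrier R) R"
    unfolding left_ideal_def
    using oneideal by (auto simp: ideal_def)
  moreover have "\<Union>{I. minimal_left_ideal I R} \<subseteq> carrier R"
    by (auto simp: minimal_left_ideal_def left_ideal_def dest: additive_subgroup.a_Hcarr)
  ultimately show "semisimple_ring R"
    unfolding semisimple_ring_def using ring_axioms by blast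
qed

section \<open>Scalars and powers of t in F(t)\<close>

lemma cring_field_ring: "cring (field_ring :: 'k::field ring)"
proof (rule cringI)
  show "abelian_group (field_ring :: 'k ring)"
  proof (rule abelian_groupI)
    show "\<exists>y\<in>carrier field_ring. y \<oplus>\<^bsub>field_ring\<^esub> x = \<zero>\<^bsub>field_ring\<^esub>" for x :: 'k
      by (rule bexI[of _ "- x"]) (auto simp: field_ring_def)
  qed (auto simp: field_ring_def)
  show "Group.comm_monoid (field_ring :: 'k ring)"
    by (rule comm_monoidI) (auto simp: field_ring_def)
qed (auto simp: field_ring_def algebra_simps)

lemma ratfun_scale_mult_left: "ratfun_scale a v * f = ratfun_scale a (v * f)"
  by (simp add: ratfun_scale_def mult.assoc)

lemma ratfun_scale_mult_right: "v * ratfun_scale a f = ratfun_scale a (v * f)"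
  by (simp add: ratfun_scale_def mult_ac)

lemma ratfun_t_power: "ratfun_t ^ n = (Fract (monom 1 n) 1 :: 'k::field ratfun)"
proof (induction n)
  case 0
  then show ?case by (simp add: One_fract_def)
next
  case (Suc n)
  then show ?case by (simp add: ratfun_t_def monom_Suc)
qed

text \<open>Lets the description of \<open>ell\<close> on basis vectors be read as a condition on
  exponents of t.\<close>

lemma ratfun_t_power_inj: "ratfun_t ^ m = (ratfun_t ^ n :: 'k::field ratfun) \<longleftrightarrow> m = n"
proof
  assume "ratfun_t ^ m = (ratfun_t ^ n :: 'k ratfun)"
  then have "monom 1 m = (monom 1 n :: 'k poly)"
    by (simp add: ratfun_t_power eq_fract)
  then show "m = n" by (metis degree_monom_eq zero_neq_one)
qed simp

section \<open>The triangular algebra and its strictly triangular part\<close>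

definition strict_tri :: "'k::field tri set" where
  "strict_tri = {Tri 0 v l 0 w 0 | v l w. True}"

lemma Tri_in_strict_tri [simp]: "Tri a v l f w b \<in> strict_tri \<longleftrightarrow> a = 0 \<and> f = 0 \<and> b = 0"
  by (auto simp: strict_tri_def)

text \<open>Collects what follows from linearity of \<open>ell\<close>; its values on powers of t
  enter in a later extension.\<close>

locale tri_ring =
  fixes ell :: "'k::field ratfun \<Rightarrow> 'k"
  assumes linear_ell: "Vector_Spaces.linear ratfun_scale (*) ell"
begin

abbreviation R where "R \<equiv> tri_algebra ell"

lemma ell_add: "ell (x + y) = ell x + ell y"
  using linear_ell by (simp add: Vector_Spaces.linear_def module_hom_def module_hom_axioms_def)

lemma ell_scale: "ell (ratfun_scale c x) = c * ell x"
  using linear_ell by (simp add: Vector_Spaces.linear_def module_hom_def module_hom_axioms_def)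

lemma ell_0 [simp]: "ell 0 = 0"
  using ell_scale[of 0 0] by simp

lemma tri_algebra_simps [simp]:
  "carrier R = UNIV" "mult R = tri_mult ell" "one R = Tri 1 0 0 1 0 1"
  "zero R = Tri 0 0 0 0 0 0" "add R = tri_add" "smult R = tri_smult"
  by (simp_all add: tri_algebra_def)

lemmas component_simps = bil_def ell_add ell_scale ratfun_scale_mult_left ratfun_scale_mult_right
  ratfun.scale_right_distrib ratfun.scale_left_distrib algebra_simps

lemma abelian_group_tri: "abelian_group R"
proof (rule abelian_groupI)
  fix x y z :: "'k tri"
  show "x \<oplus>\<^bsub>R\<^esub> y \<oplus>\<^bsub>R\<^esub> z = x \<oplus>\<^bsub>R\<^esub> (y \<oplus>\<^bsub>R\<^esub> z)" "x \<oplus>\<^bsub>R\<^esub> y = y \<oplus>\<^bsub>R\<^esub> x"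
    by (cases x; cases y; cases z; simp add: ac_simps)+
  show "\<zero>\<^bsub>R\<^esub> \<oplus>\<^bsub>R\<^esub> x = x" by (cases x) simp
  show "\<exists>y\<in>carrier R. y \<oplus>\<^bsub>R\<^esub> x = \<zero>\<^bsub>R\<^esub>"
  proof (cases x)
    case (Tri a v l f w b)
    then show ?thesis by (intro bexI[of _ "Tri (- a) (- v) (- l) (- f) (- w) (- b)"]) auto
  qed
qed auto

text \<open>Associativity in the corner entry comes from \<open>bil\<close> being F-bilinear and
  balanced over F(t): both \<open>bil ell (v * f) w\<close> and \<open>bil ell v (f * w)\<close> are
  \<open>ell\<close> of the same product.\<close>

lemma ring_tri: "ring R"
proof (rule ringI)
  show "abelian_group R" by (rule abelian_group_tri)
  show "Group.monoid R"
  proof (rule monoidI)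
    fix x y z :: "'k tri"
    show "x \<otimes>\<^bsub>R\<^esub> y \<otimes>\<^bsub>R\<^esub> z = x \<otimes>\<^bsub>R\<^esub> (y \<otimes>\<^bsub>R\<^esub> z)"
      by (cases x; cases y; cases z) (simp add: component_simps)
    show "\<one>\<^bsub>R\<^esub> \<otimes>\<^bsub>R\<^esub> x = x" "x \<otimes>\<^bsub>R\<^esub> \<one>\<^bsub>R\<^esub> = x"
      by (cases x; simp add: bil_def)+
  qed auto
  fix x y z :: "'k tri"
  show "(x \<oplus>\<^bsub>R\<^esub> y) \<otimes>\<^bsub>R\<^esub> z = x \<otimes>\<^bsub>R\<^esub> z \<oplus>\<^bsub>R\<^esub> y \<otimes>\<^bsub>R\<^esub> z"
    "z \<otimes>\<^bsub>R\<^esub> (x \<oplus>\<^bsub>R\<^esub> y) = z \<otimes>\<^bsub>R\<^esub> x \<oplus>\<^bsub>R\<^esub> z \<otimes>\<^bsub>R\<^esub> y"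
    by (cases x; cases y; cases z; simp add: component_simps)+
qed

sublocale R: ring R by (rule ring_tri)

lemma minus_Tri: "\<ominus>\<^bsub>R\<^esub> Tri a v l f w b = Tri (- a) (- v) (- l) (- f) (- w) (- b)"
  by (rule R.minus_equality) auto

lemma diff_Tri: "Tri a v l f w b \<ominus>\<^bsub>R\<^esub> Tri a' v' l' f' w' b'
    = Tri (a - a') (v - v') (l - l') (f - f') (w - w') (b - b')"
  by (simp add: a_minus_def minus_Tri)

lemma unital_algebra_tri: "unital_algebra R"
  unfolding unital_algebra_def
proof (intro conjI allI ballI)
  show "ring R" by (rule ring_tri)
  show "Module.module (field_ring :: 'k ring) R"
  proof (rule moduleI[OF cring_field_ring abelian_group_tri])
    fix c d :: 'k and x y :: "'k tri"
    show "(c \<oplus>\<^bsub>field_ring\<^esub> d) \<odot>\<^bsub>R\<^esub> x = c \<odot>\<^bsub>R\<^esub> x \<oplus>\<^bsub>R\<^esub> d \<odot>\<^bsub>R\<^esub> x"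
      "c \<odot>\<^bsub>R\<^esub> (x \<oplus>\<^bsub>R\<^esub> y) = c \<odot>\<^bsub>R\<^esub> x \<oplus>\<^bsub>R\<^esub> c \<odot>\<^bsub>R\<^esub> y"
      "(c \<otimes>\<^bsub>field_ring\<^esub> d) \<odot>\<^bsub>R\<^esub> x = c \<odot>\<^bsub>R\<^esub> (d \<odot>\<^bsub>R\<^esub> x)"
      "\<one>\<^bsub>field_ring\<^esub> \<odot>\<^bsub>R\<^esub> x = x"
      by (cases x; cases y; simp add: field_ring_def component_simps)+
  qed auto
  fix c and x y :: "'k tri"
  show "(c \<odot>\<^bsub>R\<^esub> x) \<otimes>\<^bsub>R\<^esub> y = c \<odot>\<^bsub>R\<^esub> (x \<otimes>\<^bsub>R\<^esub> y)" "x \<otimes>\<^bsub>R\<^esub> (c \<odot>\<^bsub>R\<^esub> y) = c \<odot>\<^bsub>R\<^esub> (x \<otimes>\<^bsub>R\<^esub> y)"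
    by (cases x; cases y; simp add: component_simps)+
qed

section \<open>The nilradical and its cube\<close>

lemma ideal_strict_tri: "ideal strict_tri R"
proof (rule idealI[OF ring_tri])
  show "subgroup strict_tri (add_monoid R)"
  proof (rule R.add.subgroupI)
    show "strict_tri \<noteq> {}" using Tri_in_strict_tri by blast
    show "\<ominus>\<^bsub>R\<^esub> x \<in> strict_tri" if "x \<in> strict_tri" for x
      using that by (cases x) (simp add: minus_Tri)
    show "x \<oplus>\<^bsub>R\<^esub> y \<in> strict_tri" if "x \<in> strict_tri" "y \<in> strict_tri" for x y
      using that by (cases x; cases y) simp
  qed auto
  fix x y :: "'k tri"
  assume "x \<in> strict_tri"
  then show "y \<otimes>\<^bsub>R\<^esub> x \<in> strict_tri" "x \<otimes>\<^bsub>R\<^esub> y \<in> strict_tri"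
    by (cases x; cases y; simp)+
qed

lemma Tri_power: "\<exists>v' l' w'. Tri a v l f w b [^]\<^bsub>R\<^esub> (n::nat) = Tri (a ^ n) v' l' (f ^ n) w' (b ^ n)"
proof (induction n)
  case 0
  then show ?case by simp
next
  case (Suc n)
  then show ?case by (auto simp: mult.commute)
qed

lemma nil_ideal_strict_tri: "nil_ideal strict_tri R"
  unfolding nil_ideal_def
proof (intro conjI ballI ideal_strict_tri)
  fix x assume "x \<in> (strict_tri :: 'k tri set)"
  then have "x [^]\<^bsub>R\<^esub> (3::nat) = \<zero>\<^bsub>R\<^esub>"
    by (cases x) (simp add: numeral_3_eq_3 bil_def)
  then show "\<exists>n::nat. x [^]\<^bsub>R\<^esub> n = \<zero>\<^bsub>R\<^esub>" by blast
qed

text \<open>The diagonal entries lie in fields, so those of a nilpotent element are zero.\<close>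

lemma nil_ideal_subset_strict_tri:
  assumes "nil_ideal I R" shows "I \<subseteq> strict_tri"
proof
  fix x assume "x \<in> I"
  then obtain n :: nat where n: "x [^]\<^bsub>R\<^esub> n = \<zero>\<^bsub>R\<^esub>" using assms by (auto simp: nil_ideal_def)
  obtain a v l f w b where x: "x = Tri a v l f w b" by (cases x)
  show "x \<in> strict_tri" using n Tri_power[of a v l f w b n] by (auto simp: x)
qed

lemma nilradical_tri: "nilradical R = strict_tri"
proof
  show "nilradical R \<subseteq> strict_tri"
    unfolding nilradical_def
    by (rule R.genideal_minimal[OF ideal_strict_tri]) (use nil_ideal_subset_strict_tri in blast)
  show "strict_tri \<subseteq> nilradical R"
    unfolding nilradical_def
    using R.genideal_self[of "\<Union>{I. nil_ideal I R}"] nil_ideal_strict_tri by auto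
qed

text \<open>\<open>ideal_pow\<close> starts from the whole ring, so the cube unfolds to
  \<open>((R N) N) N\<close>. Here \<open>R N\<close> lies in \<open>N\<close>, a further factor
  leaves only the corner entry, and the last factor kills it.\<close>

lemma ideal_pow_strict_tri: "ideal_pow R strict_tri 3 = {\<zero>\<^bsub>R\<^esub>}"
proof -
  define P where "P = carrier R \<cdot>\<^bsub>R\<^esub> strict_tri"
  have P: "P \<subseteq> strict_tri"
    unfolding P_def using R.ideal_prod_inter[OF R.oneideal ideal_strict_tri] by blast
  have PP: "x \<in> {Tri 0 0 l 0 0 0 | l. True}" if "x \<in> P \<cdot>\<^bsub>R\<^esub> strict_tri" for x
    using that
  proof induction
    case (prod i j)
    then have "i \<in> strict_tri" using P by blast
    then show ?case using prod(2) by (cases i; cases j) simp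
  next
    case (sum s t)
    then show ?case by auto
  qed
  have sub: "x = \<zero>\<^bsub>R\<^esub>" if "x \<in> P \<cdot>\<^bsub>R\<^esub> strict_tri \<cdot>\<^bsub>R\<^esub> strict_tri" for x
    using that
  proof induction
    case (prod i j)
    then show ?case using PP[of i] by (cases j) (auto simp: bil_def)
  qed auto
  have "ideal (P \<cdot>\<^bsub>R\<^esub> strict_tri \<cdot>\<^bsub>R\<^esub> strict_tri) R"
    unfolding P_def by (intro R.ideal_prod_is_ideal ideal_strict_tri R.oneideal)
  then have "\<zero>\<^bsub>R\<^esub> \<in> P \<cdot>\<^bsub>R\<^esub> strict_tri \<cdot>\<^bsub>R\<^esub> strict_tri"
    by (intro additive_subgroup.zero_closed) (simp add: ideal_def)
  then have "P \<cdot>\<^bsub>R\<^esub> strict_tri \<cdot>\<^bsub>R\<^esub> strict_tri = {\<zero>\<^bsub>R\<^esub>}" using sub by blast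
  then show ?thesis by (simp add: numeral_3_eq_3 P_def)
qed

section \<open>The quotient by the nilradical\<close>

text \<open>The cosets of the three diagonal idempotents are central, since modulo
  \<open>strict_tri\<close> only the diagonal remains and its entries lie in fields; they decompose
  the identity.\<close>

lemma semisimple_artinian_quotient:
  "semisimple_ring (R Quot strict_tri) \<and> left_artinian (R Quot strict_tri)"
proof -
  interpret N: ideal strict_tri R by (rule ideal_strict_tri)
  let ?D = "R Quot strict_tri"
  interpret D: ring ?D by (rule N.quotient_is_ring)
  define q where "q = (+>\<^bsub>R\<^esub>) strict_tri"
  have hom: "q \<in> Ring.ring_hom R ?D" unfolding q_def by (rule N.rcos_ring_hom)
  have q_eq: "q x = q y \<longleftrightarrow> x \<ominus>\<^bsub>R\<^esub> y \<in> strict_tri" for x y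
    unfolding q_def using R.quotient_eq_iff_same_a_r_cos[OF ideal_strict_tri] by simp
  have q_zero: "\<zero>\<^bsub>?D\<^esub> = q (Tri 0 0 0 0 0 0)" using ring_hom_zero[OF hom ring_tri D.ring_axioms] by simp
  have q_one: "\<one>\<^bsub>?D\<^esub> = q (Tri 1 0 0 1 0 1)" using ring_hom_one[OF hom] by simp
  have q_mult: "q x \<otimes>\<^bsub>?D\<^esub> q y = q (tri_mult ell x y)" for x y using ring_hom_mult[OF hom] by simp
  have q_add: "q x \<oplus>\<^bsub>?D\<^esub> q y = q (tri_add x y)" for x y using ring_hom_add[OF hom] by simp
  have q_closed: "q x \<in> carrier ?D" for x using ring_hom_closed[OF hom] by simp
  have surj: "\<exists>a v l f w b. X = q (Tri a v l f w b)" if "X \<in> carrier ?D" for X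
  proof -
    have "\<exists>x. X = q x" using that by (auto simp: FactRing_def A_RCOSETS_def' q_def)
    then show ?thesis by (metis upper_tri.exhaust)
  qed
  define e1 e2 e3 :: "'k tri"
    where "e1 = Tri 1 0 0 0 0 0" and "e2 = Tri 0 0 0 1 0 0" and "e3 = Tri 0 0 0 0 0 1"
  note e_defs = e1_def e2_def e3_def
  define E where "E = {q e1, q e2, q e3}"
  have E: "finite E" "E \<subseteq> carrier ?D" by (auto simp: E_def q_closed)
  \<comment> \<open>The three cosets are distinct, so the sum over the set \<open>E\<close> really
    has three summands.\<close>
  have one: "(\<Oplus>\<^bsub>?D\<^esub>e\<in>E. e) = \<one>\<^bsub>?D\<^esub>"
    using q_closed by (simp add: E_def q_eq e_defs diff_Tri q_one q_add q_zero)
  have central: "x \<otimes>\<^bsub>?D\<^esub> e = e \<otimes>\<^bsub>?D\<^esub> x" if x: "x \<in> carrier ?D" and e: "e \<in> E" for x e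
  proof -
    obtain a v l f w b where "x = q (Tri a v l f w b)" using surj[OF x] by blast
    then show ?thesis
      using e unfolding E_def by (elim insertE emptyE; simp add: e_defs q_mult q_eq diff_Tri)
  qed
  have simple: "x \<otimes>\<^bsub>?D\<^esub> e = \<zero>\<^bsub>?D\<^esub> \<or> (\<exists>y\<in>carrier ?D. y \<otimes>\<^bsub>?D\<^esub> (x \<otimes>\<^bsub>?D\<^esub> e) = e)"
    if x: "x \<in> carrier ?D" and e: "e \<in> E" for x e
  proof -
    obtain a v l f w b where x: "x = q (Tri a v l f w b)" using surj[OF x] by blast
    \<comment> \<open>One witness serves all three idempotents. A diagonal entry that is zero has
      \<open>inverse 0 = 0\<close>, which does no harm: a nonzero product with \<open>e\<close>
      means that the entry selected by \<open>e\<close> is invertible.\<close>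
    have inverse: "q (Tri (inverse a) 0 0 (inverse f) 0 (inverse b)) \<in> carrier ?D"
      by (rule q_closed)
    show ?thesis
      unfolding x disj_imp
    proof (intro impI bexI[OF _ inverse])
      assume "q (Tri a v l f w b) \<otimes>\<^bsub>?D\<^esub> e \<noteq> \<zero>\<^bsub>?D\<^esub>"
      then show "q (Tri (inverse a) 0 0 (inverse f) 0 (inverse b)) \<otimes>\<^bsub>?D\<^esub> (q (Tri a v l f w b) \<otimes>\<^bsub>?D\<^esub> e) = e"
        using e unfolding E_def
        by (elim insertE emptyE; simp add: e_defs q_mult q_eq q_zero diff_Tri)
    qed
  qed
  show ?thesis
    using D.semisimple_artinian_of_central_decomposition[OF E one central simple] by blast
qed

lemma semiprimary_tri: "semiprimary R"
  unfolding semiprimary_def nilradical_tri nilpotent_ideal_def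
  using ring_tri ideal_strict_tri ideal_pow_strict_tri semisimple_artinian_quotient by blast

end

section \<open>The polynomial identity\<close>

text \<open>Products with an even number of factors \<open>z\<close> come first: these keep their
  sign when \<open>z\<close> is replaced by the negative of \<open>y\<close>, as is done
  next.\<close>

lemma (in ring) cube_sum:
  assumes [simp]: "x \<in> carrier R" "z \<in> carrier R"
  shows "(x \<oplus> z) \<otimes> ((x \<oplus> z) \<otimes> (x \<oplus> z)) =
    x \<otimes> (x \<otimes> x) \<oplus> (x \<otimes> (z \<otimes> z) \<oplus> (z \<otimes> (x \<otimes> z) \<oplus> (z \<otimes> (z \<otimes> x)
    \<oplus> (z \<otimes> (z \<otimes> z) \<oplus> (z \<otimes> (x \<otimes> x) \<oplus> (x \<otimes> (z \<otimes> x) \<oplus> x \<otimes> (x \<otimes> z)))))))"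
  by (simp add: l_distr r_distr a_ac)

lemma (in ring) commutator_cube:
  assumes [simp]: "x \<in> carrier R" "y \<in> carrier R"
  shows "(x \<ominus> y) \<otimes> ((x \<ominus> y) \<otimes> (x \<ominus> y)) =
    x \<otimes> (x \<otimes> x) \<oplus> (x \<otimes> (y \<otimes> y) \<oplus> (y \<otimes> (x \<otimes> y) \<oplus> (y \<otimes> (y \<otimes> x)
    \<oplus> (\<ominus> (y \<otimes> (y \<otimes> y)) \<oplus> (\<ominus> (y \<otimes> (x \<otimes> x)) \<oplus> (\<ominus> (x \<otimes> (y \<otimes> x)) \<oplus> \<ominus> (x \<otimes> (x \<otimes> y))))))))"
  unfolding a_minus_def by (simp add: cube_sum l_minus r_minus)

context tri_ring
begin

lemma commutator_in_strict_tri: "x \<otimes>\<^bsub>R\<^esub> y \<ominus>\<^bsub>R\<^esub> y \<otimes>\<^bsub>R\<^esub> x \<in> strict_tri"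
  by (cases x; cases y) (simp add: diff_Tri mult.commute)

lemma strict_tri_triple_product:
  assumes "x \<in> strict_tri" "y \<in> strict_tri" "z \<in> strict_tri"
  shows "x \<otimes>\<^bsub>R\<^esub> (y \<otimes>\<^bsub>R\<^esub> z) = \<zero>\<^bsub>R\<^esub>"
  using assms by (cases x; cases y; cases z) (simp add: bil_def)

text \<open>The polynomial below is \<open>(x\<^sub>0 x\<^sub>1 - x\<^sub>1 x\<^sub>0)\<^sup>3\<close>: commutators are strictly triangular.\<close>

lemma PI_algebra_tri: "PI_algebra R"
proof -
  \<comment> \<open>With \<open>x\<close> for the word 01 and \<open>y\<close> for 10,
    \<open>U\<close> lists the words with sign + in the expansion of the cube of
    \<open>x - y\<close>, and \<open>V\<close> those with sign -.\<close>
  define U V :: "nat list set"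
    where "U = {[0,1,0,1,0,1], [0,1,1,0,1,0], [1,0,0,1,1,0], [1,0,1,0,0,1]}"
      and "V = {[1,0,1,0,1,0], [1,0,0,1,0,1], [0,1,1,0,0,1], [0,1,0,1,1,0]}"
  define c :: "nat list \<Rightarrow> 'k" where "c u = (if u \<in> U then 1 else if u \<in> V then - 1 else 0)" for u
  define p where "p = Abs_poly_mapping c"
  have supp: "{u. c u \<noteq> 0} = U \<union> V" by (auto simp: c_def)
  have "finite (U \<union> V)" by (simp add: U_def V_def)
  then have lookup: "Poly_Mapping.lookup p = c"
    unfolding p_def by (intro Abs_poly_mapping_inverse) (simp only: supp mem_Collect_eq)
  have keys: "Poly_Mapping.keys p = U \<union> V"
    by (simp only: keys.rep_eq lookup supp)
  have "p \<noteq> 0"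
  proof
    assume "p = 0"
    then have "U \<union> V = {}" using keys by simp
    then show False by (simp add: U_def)
  qed
  moreover have "eval_nc R x p = \<zero>\<^bsub>R\<^esub>" for x
  proof -
    let ?a = "x 0 \<otimes>\<^bsub>R\<^esub> x 1" and ?b = "x 1 \<otimes>\<^bsub>R\<^esub> x 0"
    have minus: "(- 1) \<odot>\<^bsub>R\<^esub> y = \<ominus>\<^bsub>R\<^esub> y" for y
      by (cases y) (simp add: minus_Tri ratfun.scale_minus_left)
    have one: "1 \<odot>\<^bsub>R\<^esub> y = y" for y
      by (cases y) simp
    have "eval_nc R x p = (\<Oplus>\<^bsub>R\<^esub>u\<in>V \<union> U. c u \<odot>\<^bsub>R\<^esub> eval_word R x u)"
      by (simp only: eval_nc_def lookup keys Un_commute)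
    \<comment> \<open>The component formulas are withheld from the simplifier so that the ring laws
      apply to abstract products; only \<open>carrier R\<close> is still unfolded.\<close>
    also have "\<dots> = (?a \<ominus>\<^bsub>R\<^esub> ?b) \<otimes>\<^bsub>R\<^esub> ((?a \<ominus>\<^bsub>R\<^esub> ?b) \<otimes>\<^bsub>R\<^esub> (?a \<ominus>\<^bsub>R\<^esub> ?b))"
      by (simp add: R.commutator_cube U_def V_def c_def minus one eval_word_def R.m_assoc
          del: tri_algebra_simps(2-))
    also have "\<dots> = \<zero>\<^bsub>R\<^esub>"
      by (intro strict_tri_triple_product commutator_in_strict_tri)
    finally show ?thesis .
  qed
  ultimately show ?thesis unfolding PI_algebra_def using unital_algebra_tri by blast
qed

end

section \<open>Failure of weak representability\<close>

locale tri_ring_basis = tri_ring ell for ell :: "'k::field ratfun \<Rightarrow> 'k" +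
  assumes ell_t: "ell (ratfun_t ^ n) = (if \<exists>k\<ge>1. n = 2 ^ k then 1 else 0)"
begin

lemma not_weakly_representable_tri: "\<not> weakly_representable TYPE('c::comm_ring_1) R"
proof
  assume "weakly_representable TYPE('c) R"
  then obtain n \<phi> where \<phi>: "\<phi> \<in> Ring.ring_hom R (ring_mat TYPE('c) n ())" and inj: "inj \<phi>"
    by (auto simp: weakly_representable_def)
  have closed: "\<phi> x \<in> carrier_mat n n" for x
    using ring_hom_closed[OF \<phi>, of x] by (simp add: ring_mat_simps)
  have mult: "\<phi> x * \<phi> y = \<phi> (tri_mult ell x y)" for x y
    using ring_hom_mult[OF \<phi>, of x y] by (simp add: ring_mat_simps)
  have zero: "\<phi> (Tri 0 0 0 0 0 0) = 0\<^sub>m n n"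
    using ring_hom_zero[OF \<phi> ring_tri ring_mat] by (simp add: ring_mat_simps)
  \<comment> \<open>The exponents from \<open>m\<close> to \<open>m + n\<close> end at
    \<open>2 ^ Suc n\<close>. Because \<open>n < 2 ^ n\<close>, they all exceed
    \<open>2 ^ n\<close>, so the last one is the only power of two among them.\<close>
  define m :: nat where "m = 2 ^ Suc n - n"
  have less: "n < 2 ^ n" by (rule less_exp)
  have m: "m + n = 2 * 2 ^ n"
    unfolding m_def power_Suc by (rule le_add_diff_inverse2) (use less in linarith)
  have ell_m: "ell (ratfun_t ^ (m + k)) = (if k = n then 1 else 0)" if k: "k \<le> n" for k
  proof (cases "k = n")
    case True
    then have "m + k = 2 ^ Suc n" using m by simp
    then have "\<exists>j\<ge>1. m + k = 2 ^ j" by (intro exI[of _ "Suc n"]) simp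
    then show ?thesis using True by (simp add: ell_t)
  next
    case False
    then have bounds: "2 ^ n < m + k" "m + k < 2 ^ Suc n" using less k m unfolding power_Suc by linarith+
    have "m + k \<noteq> 2 ^ j" for j
    proof
      assume "m + k = 2 ^ j"
      then have "n < j" "j < Suc n"
        using bounds by (metis power_strict_increasing_iff one_less_numeral_iff semiring_norm(76))+
      then show False by simp
    qed
    then show ?thesis using False by (simp add: ell_t)
  qed
  let ?T = "\<phi> (Tri 0 0 0 ratfun_t 0 0)"
  let ?L = "\<phi> (Tri 0 (ratfun_t ^ m) 0 0 0 0)"
  let ?R = "\<phi> (Tri 0 0 0 0 1 0)"
  \<comment> \<open>At \<open>k = 0\<close> the matrix power is the identity, not the image of the
    middle idempotent; multiplied by \<open>?L\<close> from the left, both give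
    \<open>?L\<close>.\<close>
  have "?L * ?T ^\<^sub>m k = \<phi> (Tri 0 (ratfun_t ^ (m + k)) 0 0 0 0)" for k
  proof (induction k)
    case 0
    show ?case using right_mult_one_mat[OF closed] carrier_matD(1)[OF closed] by simp
  next
    case (Suc k)
    have "?L * ?T ^\<^sub>m Suc k = ?L * ?T ^\<^sub>m k * ?T"
      using assoc_mult_mat[OF closed pow_carrier_mat[OF closed] closed] by simp
    then show ?case using Suc by (simp add: mult bil_def mult.commute)
  qed
  then have LTR: "?L * ?T ^\<^sub>m k * ?R = \<phi> (Tri 0 0 (ell (ratfun_t ^ (m + k))) 0 0 0)" for k
    by (simp add: mult bil_def)
  have "\<phi> (Tri 0 0 1 0 0 0) = 0\<^sub>m n n"
  proof (rule eq_matI)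
    fix i j assume "i < dim_row (0\<^sub>m n n :: 'c mat)" "j < dim_col (0\<^sub>m n n :: 'c mat)"
    then have ij: "i < n" "j < n" by auto
    have "0 = (\<Sum>k\<le>n. coeff (char_poly ?T) k * (?L * ?T ^\<^sub>m k * ?R) $$ (i, j))"
      by (rule char_poly_between_mats[OF closed closed closed ij, symmetric])
    \<comment> \<open>The characteristic polynomial is monic of degree \<open>n\<close>, so the term
      \<open>k = n\<close> has coefficient 1; in every other term \<open>ell\<close> gives 0 and
      \<phi> sends the zero matrix to zero.\<close>
    also have "\<dots> = (\<Sum>k\<le>n. if k = n then \<phi> (Tri 0 0 1 0 0 0) $$ (i, j) else 0)"
      using degree_monic_char_poly[OF closed] ij
      by (intro sum.cong) (auto simp: LTR ell_m zero)
    also have "\<dots> = \<phi> (Tri 0 0 1 0 0 0) $$ (i, j)" by simp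
    finally show "\<phi> (Tri 0 0 1 0 0 0) $$ (i, j) = 0\<^sub>m n n $$ (i, j)" using ij by simp
  qed (use closed in auto)
  then have "\<phi> (Tri 0 0 1 0 0 0) = \<phi> (Tri 0 0 0 0 0 0)" by (simp add: zero)
  then show False using inj by (auto dest: injD)
qed

end

theorem mainTheorem5:
  fixes B :: "'k::field ratfun set" and ell :: "'k ratfun \<Rightarrow> 'k"
  assumes "ratfun.independent B" and "ratfun.span B = UNIV"
    and "\<And>n::nat. ratfun_t ^ n \<in> B"
    and "Vector_Spaces.linear ratfun_scale (*) ell"
    and "\<And>v. v \<in> B \<Longrightarrow> ell v = (if \<exists>k::nat. k \<ge> 1 \<and> v = ratfun_t ^ (2 ^ k) then 1 else 0)"
  shows "semiprimary (tri_algebra ell) \<and> PI_algebra (tri_algebra ell) \<and>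
    ideal_pow (tri_algebra ell) (nilradical (tri_algebra ell)) 3 = {\<zero>\<^bsub>tri_algebra ell\<^esub>} \<and>
    \<not> weakly_representable TYPE('c::comm_ring_1) (tri_algebra ell)"
proof -
  \<comment> \<open>All powers of t belong to \<open>B\<close>, so the prescribed values of
    \<open>ell\<close> apply to them; as distinct exponents give distinct powers, this is
    \<open>ell_t\<close>.\<close>
  interpret tri_ring_basis ell
    by (intro tri_ring_basis.intro tri_ring.intro tri_ring_basis_axioms.intro)
      (use assms(3-5) in \<open>simp_all add: ratfun_t_power_inj\<close>)
  show ?thesis
    using semiprimary_tri PI_algebra_tri ideal_pow_strict_tri not_weakly_representable_tri
    by (simp only: nilradical_tri simp_thms)
qed

end
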